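(* Let $X$ be a connected, locally path connected and semi-locally Spanier space, and let $x\in X$. Then for every subgroup $H\le\pi_1(X,x)$ containing $\pi_1^{sp}(X,x)$ there exist a covering $p:\widetilde{X}_H\to X$ and a base point $\tilde{x}\in p^{-1}(\{x\})\subseteq\widetilde{X}_H$ such that $p_*\pi_1(\widetilde{X}_H,\tilde{x})=H$.
   Context: A covering $p:\widetilde{X}\to X$ is a continuous map such that every $x\in X$ has an open neighborhood $U$ that is evenly covered, i.e. $p^{-1}(U)$ is a disjoint union of open subsets of $\widetilde{X}$ each mapped homeomorphically onto $U$ by $p$. All covering spaces are path connected; homotopies of paths are relative to endpoints. Spanier group: for an open cover $\mathcal{U}$ of a space $X$, $\pi(\mathcal{U},x)\le\pi_1(X,x)$ is the subgroup of classes having a representative of the form $\prod_{j=1}^n u_j v_j u_j^{-1}$, with $u_j$ a path starting at $x$ and $v_j$ a loop based at $u_j(1)$ lying inside some $U_j\in\mathcal{U}$. Then $\pi_1^{sp}(X,x)=\bigcap_{\mathcal{U}}\pi(\mathcal{U},x)$ over all open covers $\mathcal{U}$. $X$ is a semi-locally Spanier space if each $x\in X$ has an open neighborhood $U$ such that $i_*\pi_1(U,x)\le\pi_1^{sp}(X,x)$, where $i:U\to X$ is the inclusion. *)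

theory Defs
  imports "HOL-Analysis.Analysis" "HOL-Algebra.Group"
begin

(* Spaces are abstract topologies, since the covering space is an existentially quantified space.
   The library's joinpaths, reversepath, homotopic_paths and covering_space need a type of class
   topological_space, so their counterparts for 'a topology are given here.  A path is a function
   on the reals of which only the restriction to {0..1} matters. *)

definition path_join :: "(real \<Rightarrow> 'a) \<Rightarrow> (real \<Rightarrow> 'a) \<Rightarrow> real \<Rightarrow> 'a" (infixr "\<star>" 75)
  where "p \<star> q = (\<lambda>t. if t \<le> 1/2 then p (2 * t) else q (2 * t - 1))"

definition path_rev :: "(real \<Rightarrow> 'a) \<Rightarrow> real \<Rightarrow> 'a"
  where "path_rev p = (\<lambda>t. p (1 - t))"

definition path_homotopic :: "'a topology \<Rightarrow> (real \<Rightarrow> 'a) \<Rightarrow> (real \<Rightarrow> 'a) \<Rightarrow> bool"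
  where "path_homotopic X p q \<longleftrightarrow>
    homotopic_with (\<lambda>r. r 0 = p 0 \<and> r 1 = p 1) (top_of_set {0..1::real}) X p q"

definition path_class :: "'a topology \<Rightarrow> (real \<Rightarrow> 'a) \<Rightarrow> (real \<Rightarrow> 'a) set"
  where "path_class X p = {q. path_homotopic X p q}"

definition loop_at :: "'a topology \<Rightarrow> 'a \<Rightarrow> (real \<Rightarrow> 'a) \<Rightarrow> bool"
  where "loop_at X x p \<longleftrightarrow> pathin X p \<and> p 0 = x \<and> p 1 = x"

(* On classes of loops at x, the union in the product is over equal sets: it is the class of the
   concatenation of any two representatives. *)
definition fundamental_group :: "'a topology \<Rightarrow> 'a \<Rightarrow> (real \<Rightarrow> 'a) set monoid"
  where "fundamental_group X x =
    \<lparr>carrier = {path_class X p |p. loop_at X x p},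
     mult = (\<lambda>A B. \<Union>p\<in>A. \<Union>q\<in>B. path_class X (p \<star> q)),
     one = path_class X (\<lambda>_. x)\<rparr>"

(* The map on path classes induced by f into Y; again the union is over equal sets. *)
definition induced_map :: "'b topology \<Rightarrow> ('a \<Rightarrow> 'b) \<Rightarrow> (real \<Rightarrow> 'a) set \<Rightarrow> (real \<Rightarrow> 'b) set"
  where "induced_map Y f A = (\<Union>p\<in>A. path_class Y (f \<circ> p))"

definition open_cover :: "'a topology \<Rightarrow> 'a set set \<Rightarrow> bool"
  where "open_cover X \<U> \<longleftrightarrow> (\<forall>U\<in>\<U>. openin X U) \<and> \<Union>\<U> = topspace X"

(* The trailing constant loop of the product does not affect the class; the empty list gives the
   trivial class, which is also obtained from a constant u and v. *)
definition spanier_group_cover :: "'a topology \<Rightarrow> 'a set set \<Rightarrow> 'a \<Rightarrow> (real \<Rightarrow> 'a) set set"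
  where "spanier_group_cover X \<U> x =
    {path_class X (foldr (\<star>) (map (\<lambda>(u, v). u \<star> v \<star> path_rev u) uvs) (\<lambda>_. x)) |uvs.
       \<forall>(u, v)\<in>set uvs. pathin X u \<and> u 0 = x \<and> loop_at X (u 1) v \<and>
                         (\<exists>U\<in>\<U>. v ` {0..1} \<subseteq> U)}"

definition spanier_group :: "'a topology \<Rightarrow> 'a \<Rightarrow> (real \<Rightarrow> 'a) set set"
  where "spanier_group X x = (\<Inter>\<U>\<in>Collect (open_cover X). spanier_group_cover X \<U> x)"

definition semilocally_spanier_space :: "'a topology \<Rightarrow> bool"
  where "semilocally_spanier_space X \<longleftrightarrow>
    (\<forall>x\<in>topspace X. \<exists>U. openin X U \<and> x \<in> U \<and>
       induced_map X id ` carrier (fundamental_group (subtopology X U) x) \<subseteq> spanier_group X x)"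

definition evenly_covered :: "'b topology \<Rightarrow> 'a topology \<Rightarrow> ('b \<Rightarrow> 'a) \<Rightarrow> 'a set \<Rightarrow> bool"
  where "evenly_covered E X p U \<longleftrightarrow>
    (\<exists>\<V>. (\<forall>V\<in>\<V>. openin E V) \<and> disjoint \<V> \<and> \<Union>\<V> = {e \<in> topspace E. p e \<in> U} \<and>
         (\<forall>V\<in>\<V>. homeomorphic_map (subtopology E V) (subtopology X U) p))"

(* Path connectedness of the total space is part of the convention for coverings. *)
definition covering_map :: "'b topology \<Rightarrow> 'a topology \<Rightarrow> ('b \<Rightarrow> 'a) \<Rightarrow> bool"
  where "covering_map E X p \<longleftrightarrow> path_connected_space E \<and> continuous_map E X p \<and>
    (\<forall>x\<in>topspace X. \<exists>U. openin X U \<and> x \<in> U \<and> evenly_covered E X p U)"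

end

(* A point of the covering space is a path a from x up to the relation identifying a with h * a for
   loops h in H, and a set of points is open if with [a] it contains all [a * g], for g a path in
   some neighbourhood of a(1).  The end point map is evenly covered over an open path connected U as
   soon as [a * g] depends only on a and g(1), for g in U.  This holds if all loops in U at some
   point y have class in the Spanier group at y: conjugating by a carries that group into the
   Spanier group at x, hence into H.  The path a lifts to the path of its initial segments, and by
   uniqueness of lifts a loop at x lifts to a loop exactly when its class is in H. *)

theory Submission
  imports Defs
begin

section \<open>Homotopies of paths and the fundamental group\<close>

text \<open>\<open>H\<close> need not be normal, so the side matters: \<open>H\<close> acts on paths
  from the left, extension happens on the right, and two extensions a g and a k with the same end
  differ on the left by the loop a g k^-1 a^-1. Hence it is conjugates of small loops that must lie
  in \<open>H\<close>, and in general a subgroup does not contain the conjugates of its elements.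
  What saves the construction is that the Spanier group is carried along by change of base point:
  conjugating a lasso u v u^-1 by w replaces its tail u by w u and leaves v, and so the member of
  the cover around v, as it was. The second obstacle is that the semi-local hypothesis controls only
  loops at the centre y of a neighbourhood, whereas [a g] has to be controlled for every starting
  point a(1) in it. Shrinking to a path connected U allows a detour through y by a path inside
  U.\<close>

abbreviation unit_interval :: "real topology"
  where "unit_interval \<equiv> top_of_set {0..1}"

lemma pathin_compose_unit_interval:
  assumes "pathin X p" "continuous_on {0..1} f" "f ` {0..1} \<subseteq> {0..1}"
  shows "pathin X (p \<circ> f)"
  using assms unfolding pathin_def
  by (intro continuous_map_compose[of _ unit_interval]) (auto simp: image_subset_iff)

lemma path_join_0 [simp]: "(p \<star> q) 0 = p 0"
  and path_join_1 [simp]: "(p \<star> q) 1 = q 1"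
  by (simp_all add: path_join_def)

lemma path_rev_0 [simp]: "path_rev p 0 = p 1"
  and path_rev_1 [simp]: "path_rev p 1 = p 0"
  by (simp_all add: path_rev_def)

lemma path_rev_rev [simp]: "path_rev (path_rev p) = p"
  by (simp add: path_rev_def)

lemma pathin_rev:
  assumes "pathin X p"
  shows "pathin X (path_rev p)"
proof -
  have "pathin X (p \<circ> (\<lambda>t. 1 - t))"
    by (rule pathin_compose_unit_interval) (auto intro!: continuous_intros assms)
  then show ?thesis
    by (simp add: path_rev_def o_def)
qed

text \<open>Pasting along the line \<open>snd z = 1/2\<close>, where the two formulas agree by
  \<open>hk\<close>. The first coordinate is the parameter of the homotopy and the second the time
  of the path, so this serves both for joining homotopies and, on one slice, for joining
  paths.\<close>

lemma continuous_map_join_homotopy: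
  assumes h: "continuous_map (prod_topology unit_interval unit_interval) X h"
    and k: "continuous_map (prod_topology unit_interval unit_interval) X k"
    and hk: "\<And>s. s \<in> {0..1} \<Longrightarrow> h (s, 1) = k (s, 0)"
  shows "continuous_map (prod_topology unit_interval unit_interval) X
    (\<lambda>z. if snd z \<le> 1/2 then h (fst z, 2 * snd z) else k (fst z, 2 * snd z - 1))"
proof -
  let ?Q = "{0..1::real} \<times> {0..1::real}"
  have sub: "continuous_map (top_of_set S) X (r \<circ> f)"
    if r: "continuous_map (prod_topology unit_interval unit_interval) X r"
      and f: "continuous_on S f" "f ` S \<subseteq> ?Q"
    for S and f :: "real \<times> real \<Rightarrow> real \<times> real" and r
    using f r by (intro continuous_map_compose[of _ "top_of_set ?Q"]) (auto simp: image_subset_iff)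
  have "continuous_map (top_of_set ?Q) X
    (\<lambda>z. if snd z \<le> 1/2 then (h \<circ> (\<lambda>z. (fst z, 2 * snd z))) z
      else (k \<circ> (\<lambda>z. (fst z, 2 * snd z - 1))) z)"
  proof (rule continuous_map_cases_le)
    have "continuous_map (top_of_set {z \<in> ?Q. snd z \<le> 1/2}) X (h \<circ> (\<lambda>z. (fst z, 2 * snd z)))"
      by (rule sub[OF h]) (auto intro!: continuous_intros)
    then show "continuous_map (subtopology (top_of_set ?Q)
        {z \<in> topspace (top_of_set ?Q). snd z \<le> 1/2}) X (h \<circ> (\<lambda>z. (fst z, 2 * snd z)))"
      by (simp add: subtopology_subtopology Int_def)
    have "continuous_map (top_of_set {z \<in> ?Q. 1/2 \<le> snd z}) X
        (k \<circ> (\<lambda>z. (fst z, 2 * snd z - 1)))"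
      by (rule sub[OF k]) (auto intro!: continuous_intros)
    then show "continuous_map (subtopology (top_of_set ?Q)
        {z \<in> topspace (top_of_set ?Q). 1/2 \<le> snd z}) X (k \<circ> (\<lambda>z. (fst z, 2 * snd z - 1)))"
      by (simp add: subtopology_subtopology Int_def)
    show "(h \<circ> (\<lambda>z. (fst z, 2 * snd z))) z = (k \<circ> (\<lambda>z. (fst z, 2 * snd z - 1))) z"
      if "z \<in> topspace (top_of_set ?Q)" "snd z = 1/2" for z
    proof -
      have "2 * snd z = 1" "2 * snd z - 1 = 0" "fst z \<in> {0..1}"
        using that by auto
      then show ?thesis
        by (simp only: o_apply hk)
    qed
  qed (auto intro!: continuous_intros)
  then show ?thesis
    by (simp add: o_def cong: if_cong)
qed

lemma pathin_join:
  assumes "pathin X p" "pathin X q" "p 1 = q 0"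
  shows "pathin X (p \<star> q)"
proof -
  let ?II = "prod_topology unit_interval unit_interval"
  \<comment> \<open>A path is regarded as a homotopy that ignores its parameter; the slice of the
    pasted map at parameter 0 is then the join.\<close>
  have c: "continuous_map ?II X (p \<circ> snd)" "continuous_map ?II X (q \<circ> snd)"
    using assms continuous_map_compose[OF continuous_map_snd] unfolding pathin_def by blast+
  have "continuous_map unit_interval ?II (\<lambda>t. (0, t))"
    by (auto intro!: continuous_intros)
  from continuous_map_compose[OF this continuous_map_join_homotopy[OF c]]
  have "continuous_map unit_interval X (p \<star> q)"
    using assms by (simp add: path_join_def o_def[of _ "Pair 0"] cong: if_cong)
  then show ?thesis
    by (simp add: pathin_def)
qed

lemma path_homotopic_ends:
  assumes "path_homotopic X p q"
  shows "q 0 = p 0" "q 1 = p 1"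
  using homotopic_with_imp_property[OF assms[unfolded path_homotopic_def]] by auto

lemma path_homotopic_imp_pathin:
  assumes "path_homotopic X p q"
  shows "pathin X p" "pathin X q"
  using homotopic_with_imp_continuous_maps[OF assms[unfolded path_homotopic_def]]
  by (auto simp: pathin_def)

lemma path_homotopic_eqI:
  assumes "pathin X p" "\<And>t. t \<in> {0..1} \<Longrightarrow> p t = q t"
  shows "path_homotopic X p q"
  unfolding path_homotopic_def
  by (rule homotopic_with_equal) (use assms in \<open>auto simp: pathin_def\<close>)

lemma path_homotopic_refl: "pathin X p \<Longrightarrow> path_homotopic X p p"
  by (rule path_homotopic_eqI) auto

lemma path_homotopic_sym: "path_homotopic X p q \<Longrightarrow> path_homotopic X q p"
  using path_homotopic_ends[of X p q] homotopic_with_symD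
  unfolding path_homotopic_def by fastforce

lemma path_homotopic_trans [trans]:
  "path_homotopic X p q \<Longrightarrow> path_homotopic X q r \<Longrightarrow> path_homotopic X p r"
  using path_homotopic_ends[of X p q] homotopic_with_trans
  unfolding path_homotopic_def by fastforce

lemma path_homotopic_compose:
  assumes "path_homotopic X p q" "continuous_map X Y f"
  shows "path_homotopic Y (f \<circ> p) (f \<circ> q)"
  using assms unfolding path_homotopic_def
  by (rule homotopic_with_compose_continuous_map_left) auto

lemma path_homotopic_join:
  assumes "path_homotopic X p p'" "path_homotopic X q q'" "p 1 = q 0"
  shows "path_homotopic X (p \<star> q) (p' \<star> q')"
proof -
  let ?II = "prod_topology unit_interval unit_interval"
  obtain h where h: "continuous_map ?II X h" "\<And>x. h (0, x) = p x" "\<And>x. h (1, x) = p' x"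
      "\<And>s. s \<in> {0..1} \<Longrightarrow> h (s, 0) = p 0 \<and> h (s, 1) = p 1"
    using assms(1) unfolding path_homotopic_def homotopic_with_def by force
  obtain k where k: "continuous_map ?II X k" "\<And>x. k (0, x) = q x" "\<And>x. k (1, x) = q' x"
      "\<And>s. s \<in> {0..1} \<Longrightarrow> k (s, 0) = q 0 \<and> k (s, 1) = q 1"
    using assms(2) unfolding path_homotopic_def homotopic_with_def by force
  have "continuous_map ?II X
      (\<lambda>z. if snd z \<le> 1/2 then h (fst z, 2 * snd z) else k (fst z, 2 * snd z - 1))"
    by (rule continuous_map_join_homotopy) (use h k assms(3) in auto)
  then show ?thesis
    unfolding path_homotopic_def homotopic_with_def
    by (rule_tac exI, rule_tac conjI, assumption) (auto simp: h k path_join_def)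
qed

text \<open>The interval is convex, so reparametrisations with equal ends are homotopic; the groupoid
  laws up to homotopy are all instances.\<close>

lemma path_homotopic_reparametrize:
  assumes "pathin X p"
    and f: "continuous_on {0..1} f" "f ` {0..1} \<subseteq> {0..1}"
    and g: "continuous_on {0..1} g" "g ` {0..1} \<subseteq> {0..1}"
    and "f 0 = g 0" "f 1 = g 1"
  shows "path_homotopic X (p \<circ> f) (p \<circ> g)"
proof -
  let ?II = "prod_topology unit_interval unit_interval"
  have conv: "(1 - s) * f t + s * g t \<in> {0..1}" if "s \<in> {0..1}" "t \<in> {0..1}" for s t
    using convex_bound_le[of "f t" 1 "g t" "1 - s" s] f(2) g(2) that
    by (auto simp: image_subset_iff)
  have "continuous_map ?II unit_interval (\<lambda>z. (1 - fst z) * f (snd z) + fst z * g (snd z))"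
    using conv by (auto intro!: continuous_intros continuous_on_compose2[OF f(1)]
        continuous_on_compose2[OF g(1)])
  then have c: "continuous_map ?II X (p \<circ> (\<lambda>z. (1 - fst z) * f (snd z) + fst z * g (snd z)))"
    using assms(1) unfolding pathin_def by (rule continuous_map_compose)
  have "homotopic_with (\<lambda>r. r 0 = p (f 0) \<and> r 1 = p (f 1)) unit_interval X (p \<circ> f) (p \<circ> g)"
    unfolding homotopic_with_def
    by (rule exI, rule conjI, rule c) (auto simp: assms(6,7) algebra_simps)
  then show ?thesis
    by (simp add: path_homotopic_def)
qed

lemma path_homotopic_assoc:
  assumes "pathin X p" "pathin X q" "pathin X r" "p 1 = q 0" "q 1 = r 0"
  shows "path_homotopic X ((p \<star> q) \<star> r) (p \<star> (q \<star> r))"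
proof -
  \<comment> \<open>The piecewise linear map that turns one bracketing into the other: [0,1/4],
    [1/4,1/2], [1/2,1] go to [0,1/2], [1/2,3/4], [3/4,1]. Its slopes 2, 1, 1/2 decrease, so it is
    the minimum of its three linear pieces and continuity is immediate.\<close>
  define f :: "real \<Rightarrow> real"
    where "f t = min (2 * t) (min (t + 1/4) ((t + 1)/2))" for t
  have pin: "pathin X (p \<star> (q \<star> r))"
    using assms by (simp add: pathin_join)
  have "path_homotopic X ((p \<star> (q \<star> r)) \<circ> f) ((p \<star> (q \<star> r)) \<circ> (\<lambda>t. t))"
    unfolding f_def
    by (rule path_homotopic_reparametrize[OF pin])
      (auto intro!: continuous_intros simp: min_le_iff_disj)
  moreover have "(p \<star> (q \<star> r)) \<circ> f = (p \<star> q) \<star> r"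
  proof
    fix t :: real
    consider "t \<le> 1/4" | "1/4 < t" "t \<le> 1/2" | "1/2 < t"
      by linarith
    then show "((p \<star> (q \<star> r)) \<circ> f) t = ((p \<star> q) \<star> r) t"
    proof cases
      case 1
      then have "f t = 2 * t" by (simp add: f_def)
      with 1 show ?thesis by (simp add: path_join_def)
    next
      case 2
      then have "f t = t + 1/4" by (simp add: f_def)
      with 2 show ?thesis by (simp add: path_join_def algebra_simps)
    next
      case 3
      then have "f t = (t + 1)/2" by (simp add: f_def)
      with 3 show ?thesis by (simp add: path_join_def algebra_simps)
    qed
  qed
  ultimately show ?thesis
    by (simp add: o_def)
qed

lemma path_homotopic_const_left:
  assumes "pathin X p" "p 0 = a"
  shows "path_homotopic X ((\<lambda>_. a) \<star> p) p"
proof -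
  \<comment> \<open>\<open>max 0 (2 * t - 1)\<close> waits at 0 during the first half and then runs
    through the whole interval.\<close>
  have "path_homotopic X (p \<circ> (\<lambda>t. max 0 (2 * t - 1))) (p \<circ> (\<lambda>t. t))"
    by (rule path_homotopic_reparametrize[OF assms(1)]) (auto intro!: continuous_intros)
  moreover have "p \<circ> (\<lambda>t. max 0 (2 * t - 1)) = (\<lambda>_. a) \<star> p"
  proof
    show "(p \<circ> (\<lambda>t. max 0 (2 * t - 1))) t = ((\<lambda>_. a) \<star> p) t" for t
      using assms(2) by (cases "t \<le> 1/2") (auto simp: path_join_def)
  qed
  ultimately show ?thesis
    by (simp add: o_def)
qed

lemma path_homotopic_const_right:
  assumes "pathin X p" "p 1 = a"
  shows "path_homotopic X (p \<star> (\<lambda>_. a)) p"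
proof -
  have "path_homotopic X (p \<circ> (\<lambda>t. min 1 (2 * t))) (p \<circ> (\<lambda>t. t))"
    by (rule path_homotopic_reparametrize[OF assms(1)]) (auto intro!: continuous_intros)
  moreover have "p \<circ> (\<lambda>t. min 1 (2 * t)) = p \<star> (\<lambda>_. a)"
  proof
    show "(p \<circ> (\<lambda>t. min 1 (2 * t))) t = (p \<star> (\<lambda>_. a)) t" for t
      using assms(2) by (cases "t \<le> 1/2") (auto simp: path_join_def)
  qed
  ultimately show ?thesis
    by (simp add: o_def)
qed

lemma path_homotopic_rev_right:
  assumes "pathin X p" "p 0 = a"
  shows "path_homotopic X (p \<star> path_rev p) (\<lambda>_. a)"
proof -
  \<comment> \<open>The tent function runs from 0 to 1 and back, so it has the same ends as the
    constant function 0.\<close>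
  have "path_homotopic X (p \<circ> (\<lambda>t. 1 - \<bar>2 * t - 1\<bar>)) (p \<circ> (\<lambda>_. 0))"
    by (rule path_homotopic_reparametrize[OF assms(1)]) (auto intro!: continuous_intros)
  moreover have "p \<circ> (\<lambda>t. 1 - \<bar>2 * t - 1\<bar>) = p \<star> path_rev p"
    by (rule ext) (auto simp: path_join_def path_rev_def abs_if algebra_simps)
  ultimately show ?thesis
    using assms(2) by (simp add: o_def)
qed

lemma path_homotopic_rev_left:
  assumes "pathin X p" "p 1 = a"
  shows "path_homotopic X (path_rev p \<star> p) (\<lambda>_. a)"
  using path_homotopic_rev_right[of X "path_rev p" a] assms by (simp add: pathin_rev)

lemma path_homotopic_join_left:
  assumes "pathin X p" "path_homotopic X q q'" "p 1 = q 0"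
  shows "path_homotopic X (p \<star> q) (p \<star> q')"
  using assms by (simp add: path_homotopic_join path_homotopic_refl)

lemma path_homotopic_join_right:
  assumes "path_homotopic X p p'" "pathin X q" "p 1 = q 0"
  shows "path_homotopic X (p \<star> q) (p' \<star> q)"
  using assms by (simp add: path_homotopic_join path_homotopic_refl)

lemma path_homotopic_rev_cancel:
  assumes "pathin X p" "pathin X q" "p 0 = q 0"
  shows "path_homotopic X (p \<star> (path_rev p \<star> q)) q"
proof -
  have "path_homotopic X (p \<star> (path_rev p \<star> q)) ((p \<star> path_rev p) \<star> q)"
    using assms by (auto intro!: path_homotopic_sym[OF path_homotopic_assoc] pathin_rev)
  also have "path_homotopic X \<dots> ((\<lambda>_. q 0) \<star> q)"
    using assms by (auto intro!: path_homotopic_join_right path_homotopic_rev_right)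
  also have "path_homotopic X \<dots> q"
    using assms by (auto intro!: path_homotopic_const_left)
  finally show ?thesis .
qed

lemma path_homotopic_rev_cancel':
  assumes "pathin X p" "pathin X q" "p 1 = q 0"
  shows "path_homotopic X (path_rev p \<star> (p \<star> q)) q"
  using path_homotopic_rev_cancel[of X "path_rev p" q] assms by (simp add: pathin_rev)

section \<open>Path classes and the group they form\<close>

lemma path_class_eq_iff:
  assumes "pathin X p"
  shows "path_class X p = path_class X q \<longleftrightarrow> path_homotopic X p q"
proof
  assume "path_class X p = path_class X q"
  \<comment> \<open>A path lies in its own class, which turns equality of classes into membership; a
    function that is not a path has the empty class.\<close>
  then have "path_homotopic X q p"
    using path_homotopic_refl[OF assms] by (auto simp: path_class_def)
  then show "path_homotopic X p q"
    by (rule path_homotopic_sym)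
next
  assume "path_homotopic X p q"
  then show "path_class X p = path_class X q"
    by (auto simp: path_class_def intro: path_homotopic_sym path_homotopic_trans)
qed

lemma path_class_eqI: "path_homotopic X p q \<Longrightarrow> path_class X p = path_class X q"
  using path_class_eq_iff path_homotopic_imp_pathin(1) by blast

lemma path_class_self: "pathin X p \<Longrightarrow> p \<in> path_class X p"
  by (simp add: path_class_def path_homotopic_refl)

lemma induced_map_path_class:
  assumes "pathin X p" "continuous_map X Y f"
  shows "induced_map Y f (path_class X p) = path_class Y (f \<circ> p)"
proof -
  have "path_class Y (f \<circ> q) = path_class Y (f \<circ> p)" if "q \<in> path_class X p" for q
    using that path_class_eqI[OF path_homotopic_compose[OF _ assms(2)]]
    by (simp add: path_class_def)
  then have "induced_map Y f (path_class X p) = (\<Union>q\<in>path_class X p. path_class Y (f \<circ> p))"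
    unfolding induced_map_def by (intro SUP_cong) auto
  then show ?thesis
    using path_class_self[OF assms(1)] by auto
qed

lemma mult_fundamental_group:
  assumes "pathin X p" "pathin X q" "p 1 = q 0"
  shows "path_class X p \<otimes>\<^bsub>fundamental_group X x\<^esub> path_class X q = path_class X (p \<star> q)"
proof -
  have "path_class X (p' \<star> q') = path_class X (p \<star> q)"
    if "p' \<in> path_class X p" "q' \<in> path_class X q" for p' q'
    using that path_class_eqI[OF path_homotopic_join[of X p p' q q']] assms(3)
    by (simp add: path_class_def)
  then have "path_class X p \<otimes>\<^bsub>fundamental_group X x\<^esub> path_class X q =
      (\<Union>p'\<in>path_class X p. \<Union>q'\<in>path_class X q. path_class X (p \<star> q))"
    unfolding fundamental_group_def monoid.simps by (intro SUP_cong) auto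
  then show ?thesis
    using path_class_self[OF assms(1)] path_class_self[OF assms(2)] by auto
qed

lemma one_fundamental_group: "\<one>\<^bsub>fundamental_group X x\<^esub> = path_class X (\<lambda>_. x)"
  by (simp add: fundamental_group_def)

lemma carrier_fundamental_group:
  "carrier (fundamental_group X x) = {path_class X p |p. loop_at X x p}"
  by (simp add: fundamental_group_def)

lemma fundamental_groupE:
  assumes "A \<in> carrier (fundamental_group X x)"
  obtains p where "A = path_class X p" "loop_at X x p"
  using assms by (auto simp: carrier_fundamental_group)

lemma loop_at_join: "loop_at X x p \<Longrightarrow> loop_at X x q \<Longrightarrow> loop_at X x (p \<star> q)"
  by (simp add: loop_at_def pathin_join)

lemma loop_at_rev: "loop_at X x p \<Longrightarrow> loop_at X x (path_rev p)"
  by (simp add: loop_at_def pathin_rev)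

lemma loop_at_const: "x \<in> topspace X \<Longrightarrow> loop_at X x (\<lambda>_. x)"
  by (simp add: loop_at_def pathin_const)

lemma group_fundamental_group:
  assumes "x \<in> topspace X"
  shows "group (fundamental_group X x)"
proof (rule groupI)
  let ?G = "fundamental_group X x"
  show "A \<otimes>\<^bsub>?G\<^esub> B \<in> carrier ?G" if A: "A \<in> carrier ?G" "B \<in> carrier ?G" for A B
  proof -
    obtain p where p: "A = path_class X p" "loop_at X x p"
      using A(1) by (rule fundamental_groupE)
    obtain q where q: "B = path_class X q" "loop_at X x q"
      using A(2) by (rule fundamental_groupE)
    have "A \<otimes>\<^bsub>?G\<^esub> B = path_class X (p \<star> q)"
      using p q by (simp add: mult_fundamental_group loop_at_def)
    then show ?thesis
      using loop_at_join[OF p(2) q(2)] by (auto simp: carrier_fundamental_group)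
  qed
  show "\<one>\<^bsub>?G\<^esub> \<in> carrier ?G"
    using loop_at_const[OF assms] by (auto simp: one_fundamental_group carrier_fundamental_group)
  show "A \<otimes>\<^bsub>?G\<^esub> B \<otimes>\<^bsub>?G\<^esub> C = A \<otimes>\<^bsub>?G\<^esub> (B \<otimes>\<^bsub>?G\<^esub> C)"
    if A: "A \<in> carrier ?G" "B \<in> carrier ?G" "C \<in> carrier ?G" for A B C
  proof -
    obtain p where p: "A = path_class X p" "loop_at X x p"
      using A(1) by (rule fundamental_groupE)
    obtain q where q: "B = path_class X q" "loop_at X x q"
      using A(2) by (rule fundamental_groupE)
    obtain r where r: "C = path_class X r" "loop_at X x r"
      using A(3) by (rule fundamental_groupE)
    show ?thesis
      using p q r path_class_eqI[OF path_homotopic_assoc[of X p q r]]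
      by (simp add: mult_fundamental_group loop_at_def pathin_join)
  qed
  show "\<one>\<^bsub>?G\<^esub> \<otimes>\<^bsub>?G\<^esub> A = A" if A: "A \<in> carrier ?G" for A
  proof -
    obtain p where p: "A = path_class X p" "loop_at X x p"
      using A by (rule fundamental_groupE)
    show ?thesis
      using p path_class_eqI[OF path_homotopic_const_left[of X p x]] assms
      by (simp add: mult_fundamental_group one_fundamental_group loop_at_def pathin_const)
  qed
  show "\<exists>B\<in>carrier ?G. B \<otimes>\<^bsub>?G\<^esub> A = \<one>\<^bsub>?G\<^esub>" if A: "A \<in> carrier ?G" for A
  proof -
    obtain p where p: "A = path_class X p" "loop_at X x p"
      using A by (rule fundamental_groupE)
    have "path_class X (path_rev p) \<otimes>\<^bsub>?G\<^esub> A = \<one>\<^bsub>?G\<^esub>"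
      using p path_class_eqI[OF path_homotopic_rev_left[of X p x]]
      by (simp add: mult_fundamental_group one_fundamental_group loop_at_def pathin_rev)
    then show ?thesis
      using loop_at_rev[OF p(2)] by (auto simp: carrier_fundamental_group)
  qed
qed

lemma inv_fundamental_group:
  assumes "loop_at X x p"
  shows "inv\<^bsub>fundamental_group X x\<^esub> path_class X p = path_class X (path_rev p)"
proof (rule group.inv_equality)
  have "p 0 \<in> topspace X"
    using assms path_image_subset_topspace[of X p] by (auto simp: loop_at_def)
  then show "group (fundamental_group X x)"
    using assms by (simp add: group_fundamental_group loop_at_def)
  show "path_class X (path_rev p) \<otimes>\<^bsub>fundamental_group X x\<^esub> path_class X p =
      \<one>\<^bsub>fundamental_group X x\<^esub>"
    using assms path_class_eqI[OF path_homotopic_rev_left[of X p x]]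
    by (simp add: mult_fundamental_group one_fundamental_group loop_at_def pathin_rev)
  show "path_class X p \<in> carrier (fundamental_group X x)"
    "path_class X (path_rev p) \<in> carrier (fundamental_group X x)"
    using assms loop_at_rev[of X x p] by (auto simp: carrier_fundamental_group)
qed

section \<open>Products of lassos\<close>

lemma pathin_ends_in_topspace:
  assumes "pathin X p"
  shows "p 0 \<in> topspace X" "p 1 \<in> topspace X"
  using path_image_subset_topspace[OF assms] by auto

text \<open>The representatives from \<open>spanier_group_cover\<close>, with their trailing
  constant loop, as a function of the list, so that induction applies.\<close>

definition lasso_product :: "'a \<Rightarrow> ((real \<Rightarrow> 'a) \<times> (real \<Rightarrow> 'a)) list \<Rightarrow> real \<Rightarrow> 'a"
  where "lasso_product x uvs = foldr (\<star>) (map (\<lambda>(u, v). u \<star> v \<star> path_rev u) uvs) (\<lambda>_. x)"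

text \<open>The conditions of \<open>spanier_group_cover\<close> on a pair without the one on the
  cover. That one concerns the loop alone and is unaffected when the tail is changed.\<close>

definition lasso_at :: "'a topology \<Rightarrow> 'a \<Rightarrow> (real \<Rightarrow> 'a) \<times> (real \<Rightarrow> 'a) \<Rightarrow> bool"
  where "lasso_at X x uv \<longleftrightarrow> pathin X (fst uv) \<and> fst uv 0 = x \<and> loop_at X (fst uv 1) (snd uv)"

lemma lasso_product_simps [simp]:
  "lasso_product x [] = (\<lambda>_. x)"
  "lasso_product x ((u, v) # uvs) = (u \<star> v \<star> path_rev u) \<star> lasso_product x uvs"
  by (simp_all add: lasso_product_def)

lemma loop_at_lasso_product:
  assumes "x \<in> topspace X" "list_all (lasso_at X x) uvs"
  shows "loop_at X x (lasso_product x uvs)"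
  using assms(2)
  by (induction uvs)
    (auto simp: assms(1) loop_at_const lasso_at_def loop_at_def pathin_join pathin_rev)

text \<open>Up to homotopy w (u v u^-1) is (w u) v (w u)^-1 w, so w slides through the product from
  left to right, lengthening one tail at a time. Keeping w at the right end, instead of conjugating
  by it, lets the induction hypothesis take over directly.\<close>

lemma lasso_product_change_base:
  assumes w: "pathin X w" "w 0 = x" "w 1 = y"
    and "list_all (lasso_at X y) uvs"
  shows "path_homotopic X (w \<star> lasso_product y uvs)
    (lasso_product x (map (\<lambda>(u, v). (w \<star> u, v)) uvs) \<star> w)"
  using assms(4)
proof (induction uvs)
  case Nil
  have "path_homotopic X (w \<star> (\<lambda>_. y)) w"
    using w by (intro path_homotopic_const_right)
  also have "path_homotopic X w ((\<lambda>_. x) \<star> w)"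
    using w by (intro path_homotopic_sym[OF path_homotopic_const_left])
  finally show ?case by simp
next
  case (Cons uv uvs)
  obtain u v where uv: "uv = (u, v)"
    by fastforce
  define F where "F = lasso_product y uvs"
  define F' where "F' = lasso_product x (map (\<lambda>(u, v). (w \<star> u, v)) uvs)"
  have u: "pathin X u" "u 0 = y" and v: "pathin X v" "v 0 = u 1" "v 1 = u 1"
    using Cons.prems by (auto simp: uv lasso_at_def loop_at_def)
  have F: "pathin X F" "F 0 = y" "F 1 = y"
    using loop_at_lasso_product[of y X uvs] pathin_ends_in_topspace[OF w(1)] Cons.prems w
    by (auto simp: F_def loop_at_def)
  have IH: "path_homotopic X (w \<star> F) (F' \<star> w)"
    using Cons by (simp add: F_def F'_def)
  have F': "pathin X F'" "F' 0 = x" "F' 1 = x"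
  proof -
    have "list_all (lasso_at X x) (map (\<lambda>(u, v). (w \<star> u, v)) uvs)"
      using Cons.prems w by (auto simp: list_all_iff lasso_at_def pathin_join)
    then have "loop_at X x F'"
      unfolding F'_def using pathin_ends_in_topspace[OF w(1)] w by (intro loop_at_lasso_product) auto
    then show "pathin X F'" "F' 0 = x" "F' 1 = x"
      by (auto simp: loop_at_def)
  qed
  note path = w u v F F' pathin_join pathin_rev
  \<comment> \<open>The chain starts from the product with lengthened tails and so proves the claim
    in the opposite direction; symmetry is applied at the end.\<close>
  have "path_homotopic X ((((w \<star> u) \<star> v \<star> path_rev (w \<star> u)) \<star> F') \<star> w)
      (((w \<star> u) \<star> v \<star> path_rev (w \<star> u)) \<star> F' \<star> w)"
    by (intro path_homotopic_assoc) (simp_all add: path)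
  also have "path_homotopic X \<dots> (((w \<star> u) \<star> v \<star> path_rev (w \<star> u)) \<star> w \<star> F)"
    by (intro path_homotopic_join_left path_homotopic_sym[OF IH]) (simp_all add: path)
  also have "path_homotopic X \<dots> ((w \<star> u) \<star> (v \<star> path_rev (w \<star> u)) \<star> w \<star> F)"
    by (intro path_homotopic_assoc) (simp_all add: path)
  also have "path_homotopic X \<dots> (w \<star> u \<star> (v \<star> path_rev (w \<star> u)) \<star> w \<star> F)"
    by (intro path_homotopic_assoc) (simp_all add: path)
  also have "path_homotopic X \<dots> (w \<star> u \<star> v \<star> path_rev (w \<star> u) \<star> w \<star> F)"
    by (intro path_homotopic_join_left path_homotopic_assoc) (simp_all add: path)
  also have "path_homotopic X \<dots> (w \<star> u \<star> v \<star> path_rev u \<star> F)"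
  proof -
    \<comment> \<open>Inserting u u^-1 in front of \<open>F\<close> completes w to
      \<open>w \<star> u\<close>, which then cancels against its reverse.\<close>
    have "path_homotopic X (path_rev (w \<star> u) \<star> w \<star> F)
        (path_rev (w \<star> u) \<star> w \<star> u \<star> path_rev u \<star> F)"
      by (intro path_homotopic_join_left path_homotopic_sym[OF path_homotopic_rev_cancel])
        (simp_all add: path)
    also have "path_homotopic X \<dots> (path_rev (w \<star> u) \<star> (w \<star> u) \<star> path_rev u \<star> F)"
      by (intro path_homotopic_join_left path_homotopic_sym[OF path_homotopic_assoc])
        (simp_all add: path)
    also have "path_homotopic X \<dots> (path_rev u \<star> F)"
      by (intro path_homotopic_rev_cancel') (simp_all add: path)
    finally show ?thesis
      by (intro path_homotopic_join_left) (simp_all add: path)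
  qed
  also have "path_homotopic X \<dots> (w \<star> u \<star> (v \<star> path_rev u) \<star> F)"
    by (intro path_homotopic_join_left path_homotopic_sym[OF path_homotopic_assoc])
      (simp_all add: path)
  also have "path_homotopic X \<dots> (w \<star> (u \<star> v \<star> path_rev u) \<star> F)"
    by (intro path_homotopic_join_left path_homotopic_sym[OF path_homotopic_assoc])
      (simp_all add: path)
  finally have "path_homotopic X ((((w \<star> u) \<star> v \<star> path_rev (w \<star> u)) \<star> F') \<star> w)
    (w \<star> (u \<star> v \<star> path_rev u) \<star> F)" .
  then show ?case
    using path_homotopic_sym by (simp add: uv F_def F'_def)
qed

lemma spanier_group_cover_eq:
  "spanier_group_cover X \<U> x = {path_class X (lasso_product x uvs) |uvs.
    list_all (lasso_at X x) uvs \<and> (\<forall>(u, v)\<in>set uvs. \<exists>U\<in>\<U>. v ` {0..1} \<subseteq> U)}"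
  unfolding spanier_group_cover_def lasso_product_def list_all_iff lasso_at_def
  by (intro Collect_cong ex_cong1 conj_cong refl) fastforce

text \<open>It suffices to argue for each cover separately: a product of lassos for \<open>p\<close>
  at \<open>y\<close> becomes one for the conjugate at \<open>x\<close> by lengthening the tails,
  while the loops stay in the same members of the cover. The remaining w w^-1 on the right
  cancels.\<close>

lemma spanier_group_change_base:
  assumes w: "pathin X w" "w 0 = x" "w 1 = y"
    and p: "loop_at X y p" "path_class X p \<in> spanier_group X y"
  shows "path_class X (w \<star> p \<star> path_rev w) \<in> spanier_group X x"
  unfolding spanier_group_def
proof (intro INT_I)
  fix \<U> :: "'a set set"
  assume "\<U> \<in> Collect (open_cover X)"
  then have "path_class X p \<in> spanier_group_cover X \<U> y"
    using p(2) by (auto simp: spanier_group_def)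
  then obtain uvs where uvs: "path_class X p = path_class X (lasso_product y uvs)"
    "list_all (lasso_at X y) uvs" "\<And>u v. (u, v) \<in> set uvs \<Longrightarrow> \<exists>U\<in>\<U>. v ` {0..1} \<subseteq> U"
    by (force simp: spanier_group_cover_eq)
  define F where "F = lasso_product y uvs"
  define uvs' where "uvs' = map (\<lambda>(u, v). (w \<star> u, v)) uvs"
  define F' where "F' = lasso_product x uvs'"
  have uvs': "list_all (lasso_at X x) uvs'"
    using uvs(2) w by (auto simp: list_all_iff lasso_at_def uvs'_def pathin_join)
  have pF: "path_homotopic X p F"
    using uvs(1) p(1) path_class_eq_iff by (auto simp: F_def loop_at_def)
  have F': "loop_at X x F'"
    using loop_at_lasso_product[OF _ uvs'] pathin_ends_in_topspace[OF w(1)] w by (simp add: F'_def)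
  have pp: "pathin X p" "p 0 = y" "p 1 = y" and pF': "pathin X F'" "F' 0 = x" "F' 1 = x"
    using p(1) F' by (auto simp: loop_at_def)
  have pinF: "pathin X F" "F 0 = y" "F 1 = y"
    using path_homotopic_imp_pathin[OF pF] path_homotopic_ends[OF pF] pp by auto
  note path = w pp pF' pinF pathin_join pathin_rev
  have "path_homotopic X (w \<star> p \<star> path_rev w) (w \<star> F \<star> path_rev w)"
    by (intro path_homotopic_join_left path_homotopic_join_right pF) (simp_all add: path)
  also have "path_homotopic X \<dots> ((w \<star> F) \<star> path_rev w)"
    by (intro path_homotopic_sym[OF path_homotopic_assoc]) (simp_all add: path)
  also have "path_homotopic X \<dots> ((F' \<star> w) \<star> path_rev w)"
  proof (intro path_homotopic_join_right)
    show "path_homotopic X (w \<star> F) (F' \<star> w)"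
      unfolding F_def F'_def uvs'_def using w uvs(2) by (rule lasso_product_change_base)
  qed (simp_all add: path)
  also have "path_homotopic X \<dots> (F' \<star> w \<star> path_rev w)"
    by (intro path_homotopic_assoc) (simp_all add: path)
  also have "path_homotopic X \<dots> (F' \<star> (\<lambda>_. x))"
    by (intro path_homotopic_join_left path_homotopic_rev_right) (simp_all add: path)
  also have "path_homotopic X \<dots> F'"
    by (intro path_homotopic_const_right) (simp_all add: path)
  finally have "path_class X (w \<star> p \<star> path_rev w) = path_class X (lasso_product x uvs')"
    unfolding F'_def by (rule path_class_eqI)
  moreover have "\<forall>(u, v)\<in>set uvs'. \<exists>U\<in>\<U>. v ` {0..1} \<subseteq> U"
    using uvs(3) by (auto simp: uvs'_def)
  ultimately show "path_class X (w \<star> p \<star> path_rev w) \<in> spanier_group_cover X \<U> x"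
    using uvs' by (auto simp: spanier_group_cover_eq)
qed

section \<open>The covering space of a subgroup\<close>

lemma path_connectedin_obtain_path:
  assumes "path_connectedin X S" "a \<in> S" "b \<in> S"
  obtains g where "pathin (subtopology X S) g" "g 0 = a" "g 1 = b"
proof -
  have "path_connected_space (subtopology X S)" "S \<subseteq> topspace X"
    using assms(1) by (auto simp: path_connectedin_def)
  then have "path_component_of (subtopology X S) a b"
    using assms(2,3)
    by (intro path_connected_space_imp_path_component_of) (auto simp: topspace_subtopology_subset)
  then show thesis
    using that by (auto simp: path_component_of_def)
qed

text \<open>The times at which the lifts agree and those at which they differ are both open, and the
  interval is connected. The value at 1 is the one that decides whether a lift closes up.\<close>

lemma covering_map_unique_lift:
  assumes E: "covering_map E X p"
    and f: "pathin E f" and g: "pathin E g"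
    and fg: "\<And>t. t \<in> {0..1} \<Longrightarrow> p (f t) = p (g t)"
    and "f 0 = g 0"
  shows "f 1 = g 1"
proof (rule ccontr)
  assume "f 1 \<noteq> g 1"
  define S where "S = {t \<in> {0..1::real}. f t = g t}"
  define S' where "S' = {t \<in> {0..1::real}. f t \<noteq> g t}"
  have locally_constant: "\<exists>T. openin unit_interval T \<and> t \<in> T \<and> (T \<subseteq> S \<or> T \<subseteq> S')"
    if t: "t \<in> {0..1}" for t
  proof -
    have top: "f t \<in> topspace E" "g t \<in> topspace E"
      using t path_image_subset_topspace[OF f] path_image_subset_topspace[OF g] by auto
    then have "p (f t) \<in> topspace X"
      using E by (auto simp: covering_map_def continuous_map_def)
    then obtain U where U: "openin X U" "p (f t) \<in> U" "evenly_covered E X p U"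
      using E unfolding covering_map_def by meson
    obtain \<V> where "(\<forall>V\<in>\<V>. openin E V) \<and> disjoint \<V> \<and>
        \<Union>\<V> = {e \<in> topspace E. p e \<in> U} \<and>
        (\<forall>V\<in>\<V>. homeomorphic_map (subtopology E V) (subtopology X U) p)"
      using U(3) unfolding evenly_covered_def by (rule exE)
    then have \<V>: "\<And>V. V \<in> \<V> \<Longrightarrow> openin E V" "disjoint \<V>"
        "\<Union>\<V> = {e \<in> topspace E. p e \<in> U}"
        "\<And>V. V \<in> \<V> \<Longrightarrow> homeomorphic_map (subtopology E V) (subtopology X U) p"
      by simp_all
    have "f t \<in> \<Union>\<V>" "g t \<in> \<Union>\<V>"
      using top U fg[OF t] \<V>(3) by auto
    then obtain V W where V: "V \<in> \<V>" "f t \<in> V" and W: "W \<in> \<V>" "g t \<in> W"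
      by blast
    \<comment> \<open>Throughout \<open>T\<close> the lift f stays in the sheet V and g in W. If V =
      W, injectivity of \<open>p\<close> on V makes them agree; if not, V and W are disjoint and
      they differ.\<close>
    define T where "T = {s \<in> {0..1}. f s \<in> V} \<inter> {s \<in> {0..1}. g s \<in> W}"
    have "openin unit_interval T"
      unfolding T_def
      using openin_continuous_map_preimage[of unit_interval E f V]
        openin_continuous_map_preimage[of unit_interval E g W] f g \<V>(1) V W
      by (auto simp: pathin_def)
    moreover have "t \<in> T"
      using t V W by (simp add: T_def)
    moreover have "T \<subseteq> S \<or> T \<subseteq> S'"
    proof (cases "V = W")
      case True
      have "inj_on p V"
        using \<V>(4)[OF V(1)] openin_subset[OF \<V>(1)[OF V(1)]]
        by (simp add: homeomorphic_map_def inf.absorb2)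
      then have "T \<subseteq> S"
        using fg True by (auto simp: T_def S_def inj_on_def)
      then show ?thesis ..
    next
      case False
      then have "V \<inter> W = {}"
        using \<V>(2) V W by (auto simp: pairwise_def disjnt_def)
      then have "T \<subseteq> S'"
        by (auto simp: T_def S'_def)
      then show ?thesis ..
    qed
    ultimately show ?thesis by blast
  qed
  have "openin unit_interval S"
    using locally_constant by (subst openin_subopen) (fastforce simp: S_def S'_def)
  moreover have "openin unit_interval S'"
    using locally_constant by (subst openin_subopen) (fastforce simp: S_def S'_def)
  moreover have "connected_space unit_interval"
    by (simp add: connected_space_subtopology connectedin_iff_connected)
  moreover have "topspace unit_interval \<subseteq> S \<union> S'" "S \<inter> S' = {}" "0 \<in> S" "1 \<in> S'"
    using \<open>f 1 \<noteq> g 1\<close> \<open>f 0 = g 0\<close> by (auto simp: S_def S'_def)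
  ultimately show False
    unfolding connected_space_def by blast
qed

section \<open>Paths from the base point modulo the left action of the subgroup\<close>

locale subgroup_cover =
  fixes X :: "'a topology" and x :: 'a and H :: "(real \<Rightarrow> 'a) set set"
  assumes base_in_topspace: "x \<in> topspace X"
    and subgroup_H: "subgroup H (fundamental_group X x)"
begin

definition based :: "(real \<Rightarrow> 'a) \<Rightarrow> bool"
  where "based a \<longleftrightarrow> pathin X a \<and> a 0 = x"

definition H_loop :: "(real \<Rightarrow> 'a) \<Rightarrow> bool"
  where "H_loop h \<longleftrightarrow> loop_at X x h \<and> path_class X h \<in> H"

text \<open>The join takes its value at 1/2 from \<open>h\<close>, so \<open>h \<star> b\<close>
  never reads \<open>b 0\<close>; hence \<open>based b\<close> is demanded separately. For a it
  follows from the homotopy.\<close>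

definition H_related :: "(real \<Rightarrow> 'a) \<Rightarrow> (real \<Rightarrow> 'a) \<Rightarrow> bool"
  where "H_related a b \<longleftrightarrow> based b \<and> (\<exists>h. H_loop h \<and> path_homotopic X a (h \<star> b))"

definition H_class :: "(real \<Rightarrow> 'a) \<Rightarrow> (real \<Rightarrow> 'a) set"
  where "H_class a = {b. H_related a b}"

text \<open>Related paths have the same end, so on an \<open>H_class\<close> the choice of the
  member does not matter.\<close>

definition endpoint :: "(real \<Rightarrow> 'a) set \<Rightarrow> 'a"
  where "endpoint A = (SOME a. a \<in> A) 1"

text \<open>These become the basic neighbourhoods. If \<open>a 1\<close> is not in U, there is no
  such g and the sheet is empty.\<close>

definition sheet :: "'a set \<Rightarrow> (real \<Rightarrow> 'a) \<Rightarrow> (real \<Rightarrow> 'a) set set"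
  where "sheet U a = {H_class (a \<star> g) |g. pathin (subtopology X U) g \<and> g 0 = a 1}"

text \<open>The whisker topology. The neighbourhood condition makes the axioms of a topology easy;
  that sheets are themselves open is a separate fact, \<open>openin_sheet\<close>. Quantifying over
  all representatives of a point avoids choosing one.\<close>

definition cover_space :: "(real \<Rightarrow> 'a) set topology"
  where "cover_space = topology (\<lambda>W. W \<subseteq> H_class ` Collect based \<and>
    (\<forall>a. based a \<and> H_class a \<in> W \<longrightarrow> (\<exists>U. openin X U \<and> a 1 \<in> U \<and> sheet U a \<subseteq> W)))"

lemma H_loop_const: "H_loop (\<lambda>_. x)"
  using subgroup.one_closed[OF subgroup_H] base_in_topspace
  by (simp add: H_loop_def loop_at_const one_fundamental_group)

lemma H_loop_join: "H_loop g \<Longrightarrow> H_loop h \<Longrightarrow> H_loop (g \<star> h)"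
  using subgroup.m_closed[OF subgroup_H, of "path_class X g" "path_class X h"]
  by (simp add: H_loop_def loop_at_def mult_fundamental_group pathin_join)

lemma H_loop_rev: "H_loop h \<Longrightarrow> H_loop (path_rev h)"
  using subgroup.m_inv_closed[OF subgroup_H, of "path_class X h"]
  by (simp add: H_loop_def loop_at_rev inv_fundamental_group)

lemma H_loop_homotopic:
  assumes "H_loop h" "path_homotopic X h g"
  shows "H_loop g"
  using assms path_class_eqI[OF assms(2)] path_homotopic_imp_pathin[OF assms(2)]
    path_homotopic_ends[OF assms(2)]
  by (simp add: H_loop_def loop_at_def)

lemma H_loopD: "H_loop h \<Longrightarrow> pathin X h" "H_loop h \<Longrightarrow> h 0 = x" "H_loop h \<Longrightarrow> h 1 = x"
  by (simp_all add: H_loop_def loop_at_def)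

lemma basedD: "based a \<Longrightarrow> pathin X a" "based a \<Longrightarrow> a 0 = x"
  by (simp_all add: based_def)

lemmas path_simps = based_def H_loopD pathin_join pathin_rev

lemma based_const: "based (\<lambda>_. x)"
  using base_in_topspace by (simp add: based_def pathin_const)

lemma based_join: "based a \<Longrightarrow> pathin X g \<Longrightarrow> g 0 = a 1 \<Longrightarrow> based (a \<star> g)"
  by (simp add: based_def pathin_join)

lemma H_related_based:
  assumes "H_related a b"
  shows "based a" "based b" "a 1 = b 1"
proof -
  obtain h where h: "H_loop h" "path_homotopic X a (h \<star> b)" and "based b"
    using assms by (auto simp: H_related_def)
  show "based b"
    by fact
  have "a 0 = x" "a 1 = b 1"
    using path_homotopic_ends[OF h(2)] H_loopD(2)[OF h(1)] by simp_all
  then show "based a" "a 1 = b 1"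
    using path_homotopic_imp_pathin(1)[OF h(2)] by (simp_all add: based_def)
qed

lemma H_related_homotopic:
  assumes "path_homotopic X a b" "based a"
  shows "H_related a b"
proof -
  have b: "based b"
    using assms path_homotopic_imp_pathin(2)[OF assms(1)] path_homotopic_ends(1)[OF assms(1)]
    by (simp add: based_def)
  have "path_homotopic X a ((\<lambda>_. x) \<star> b)"
    using b by (intro path_homotopic_trans[OF assms(1)]
        path_homotopic_sym[OF path_homotopic_const_left]) (simp_all add: based_def)
  then show ?thesis
    using b H_loop_const by (auto simp: H_related_def)
qed

text \<open>Reflexivity, symmetry and transitivity reflect that \<open>H\<close> contains the unit,
  inverses and products.\<close>

lemma H_related_refl: "based a \<Longrightarrow> H_related a a"
  by (simp add: H_related_homotopic based_def path_homotopic_refl)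

lemma H_related_sym:
  assumes "H_related a b"
  shows "H_related b a"
proof -
  have a: "based a" and b: "based b"
    using H_related_based[OF assms] by auto
  obtain h where h: "H_loop h" "path_homotopic X a (h \<star> b)"
    using assms by (auto simp: H_related_def)
  have "path_homotopic X (path_rev h \<star> a) (path_rev h \<star> h \<star> b)"
    using h a by (intro path_homotopic_join_left) (simp_all add: path_simps)
  also have "path_homotopic X \<dots> b"
    using h b by (intro path_homotopic_rev_cancel') (simp_all add: path_simps)
  finally show ?thesis
    using a H_loop_rev[OF h(1)] path_homotopic_sym by (auto simp: H_related_def)
qed

lemma H_related_trans [trans]:
  assumes "H_related a b" "H_related b c"
  shows "H_related a c"
proof -
  have b: "based b" and c: "based c"
    using H_related_based[OF assms(2)] by auto
  obtain g where g: "H_loop g" "path_homotopic X a (g \<star> b)"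
    using assms(1) by (auto simp: H_related_def)
  obtain h where h: "H_loop h" "path_homotopic X b (h \<star> c)"
    using assms(2) by (auto simp: H_related_def)
  note g(2)
  also have "path_homotopic X (g \<star> b) (g \<star> h \<star> c)"
    using g h b by (intro path_homotopic_join_left) (simp_all add: path_simps)
  also have "path_homotopic X \<dots> ((g \<star> h) \<star> c)"
    using g h c by (intro path_homotopic_sym[OF path_homotopic_assoc]) (simp_all add: path_simps)
  finally show ?thesis
    using c H_loop_join[OF g(1) h(1)] by (auto simp: H_related_def)
qed

text \<open>The loop in \<open>H\<close> is attached on the left and g on the right, so by
  associativity the two operations commute.\<close>

lemma H_related_join:
  assumes "H_related a b" "pathin X g" "g 0 = a 1"
  shows "H_related (a \<star> g) (b \<star> g)"
proof -
  have a: "based a" and b: "based b" "g 0 = b 1"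
    using H_related_based[OF assms(1)] assms(3) by auto
  obtain h where h: "H_loop h" "path_homotopic X a (h \<star> b)"
    using assms(1) by (auto simp: H_related_def)
  have "path_homotopic X (a \<star> g) ((h \<star> b) \<star> g)"
    using h a assms(2,3) by (intro path_homotopic_join_right) (simp_all add: path_simps)
  also have "path_homotopic X \<dots> (h \<star> b \<star> g)"
    using h b assms(2) by (intro path_homotopic_assoc) (simp_all add: path_simps)
  finally show ?thesis
    using h(1) based_join[OF b(1) assms(2) b(2)] by (auto simp: H_related_def)
qed

lemma H_class_eq_iff:
  assumes "based a"
  shows "H_class a = H_class b \<longleftrightarrow> H_related a b"
proof
  assume "H_class a = H_class b"
  then have "H_related b a"
    using H_related_refl[OF assms] by (auto simp: H_class_def)
  then show "H_related a b"
    by (rule H_related_sym)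
next
  assume "H_related a b"
  then show "H_class a = H_class b"
    by (auto simp: H_class_def intro: H_related_sym H_related_trans)
qed

lemma H_class_eqI: "path_homotopic X a b \<Longrightarrow> based a \<Longrightarrow> H_class a = H_class b"
  by (simp add: H_class_eq_iff H_related_homotopic)

lemma H_class_join_cong:
  assumes "based a" "H_class a = H_class b" "pathin X g" "g 0 = a 1"
  shows "H_class (a \<star> g) = H_class (b \<star> g)"
  using assms by (simp add: H_class_eq_iff H_related_join based_join)

lemma H_class_assoc:
  assumes "based a" "pathin X g" "g 0 = a 1" "pathin X k" "k 0 = g 1"
  shows "H_class ((a \<star> g) \<star> k) = H_class (a \<star> g \<star> k)"
  using assms
  by (intro H_class_eqI path_homotopic_assoc) (simp_all add: path_simps)

lemma H_class_const_right:
  assumes "based a"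
  shows "H_class (a \<star> (\<lambda>_. a 1)) = H_class a"
  by (rule H_class_eqI[OF path_homotopic_sym, symmetric])
    (use assms in \<open>simp_all add: path_homotopic_const_right based_def\<close>)

text \<open>This recovers \<open>H\<close> from the cover: the lift of a will end at
  \<open>H_class a\<close> and start at the class of the constant path, so it closes up exactly for
  classes in \<open>H\<close>. A loop related to the constant path is homotopic to some h followed
  by that path, hence to h.\<close>

lemma H_class_eq_const_iff:
  assumes "loop_at X x a"
  shows "H_class a = H_class (\<lambda>_. x) \<longleftrightarrow> path_class X a \<in> H"
proof -
  have a: "based a"
    using assms by (simp add: based_def loop_at_def)
  have const: "path_homotopic X (h \<star> (\<lambda>_. x)) h" if "H_loop h" for h
    using that by (intro path_homotopic_const_right) (simp_all add: path_simps)
  have "(\<exists>h. H_loop h \<and> path_homotopic X a (h \<star> (\<lambda>_. x))) \<longleftrightarrow> H_loop a"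
  proof
    assume "\<exists>h. H_loop h \<and> path_homotopic X a (h \<star> (\<lambda>_. x))"
    then obtain h where h: "H_loop h" "path_homotopic X a (h \<star> (\<lambda>_. x))"
      by blast
    from h(2) const[OF h(1)] have "path_homotopic X a h"
      by (rule path_homotopic_trans)
    then show "H_loop a"
      by (rule H_loop_homotopic[OF h(1) path_homotopic_sym])
  next
    assume "H_loop a"
    then show "\<exists>h. H_loop h \<and> path_homotopic X a (h \<star> (\<lambda>_. x))"
      using path_homotopic_sym[OF const] by blast
  qed
  then show ?thesis
    using a assms by (simp add: H_class_eq_iff H_related_def based_const H_loop_def)
qed

lemma endpoint_H_class:
  assumes "based a"
  shows "endpoint (H_class a) = a 1"
proof -
  have "H_related a (SOME b. b \<in> H_class a)"
    using someI[of "\<lambda>b. b \<in> H_class a" a] H_related_refl[OF assms] by (simp add: H_class_def)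
  then show ?thesis
    using H_related_based(3)[of a "SOME b. b \<in> H_class a"] by (simp add: endpoint_def)
qed

section \<open>The topology of the cover and its sheets\<close>

lemma openin_cover_space:
  "openin cover_space W \<longleftrightarrow> W \<subseteq> H_class ` Collect based \<and>
    (\<forall>a. based a \<and> H_class a \<in> W \<longrightarrow> (\<exists>U. openin X U \<and> a 1 \<in> U \<and> sheet U a \<subseteq> W))"
proof -
  have mono: "sheet U a \<subseteq> sheet V a" if "U \<subseteq> V" for U V a
    using that by (fastforce simp: sheet_def pathin_subtopology)
  have "istopology (\<lambda>W. W \<subseteq> H_class ` Collect based \<and>
    (\<forall>a. based a \<and> H_class a \<in> W \<longrightarrow> (\<exists>U. openin X U \<and> a 1 \<in> U \<and> sheet U a \<subseteq> W)))"
    (is "istopology ?P")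
    unfolding istopology_def
  proof (intro conjI allI impI)
    fix V W assume "?P V" "?P W"
    then show "V \<inter> W \<subseteq> H_class ` Collect based"
      by blast
    fix a assume a: "based a \<and> H_class a \<in> V \<inter> W"
    obtain S T where "openin X S" "a 1 \<in> S" "sheet S a \<subseteq> V"
      "openin X T" "a 1 \<in> T" "sheet T a \<subseteq> W"
      using \<open>?P V\<close> \<open>?P W\<close> a by (meson IntD1 IntD2)
    then show "\<exists>U. openin X U \<and> a 1 \<in> U \<and> sheet U a \<subseteq> V \<inter> W"
      using mono[of "S \<inter> T"] by (intro exI[of _ "S \<inter> T"]) blast
  next
    fix \<K> assume K: "\<forall>K\<in>\<K>. ?P K"
    then show "\<Union>\<K> \<subseteq> H_class ` Collect based"
      by blast
    fix a assume "based a \<and> H_class a \<in> \<Union>\<K>"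
    then show "\<exists>U. openin X U \<and> a 1 \<in> U \<and> sheet U a \<subseteq> \<Union>\<K>"
      using K by (meson UnionE Union_upper subset_trans)
  qed
  then show ?thesis
    by (simp add: cover_space_def)
qed

lemma topspace_cover_space: "topspace cover_space = H_class ` Collect based"
proof
  have "\<exists>U. openin X U \<and> a 1 \<in> U \<and> sheet U a \<subseteq> H_class ` Collect based" if "based a" for a
    using that pathin_ends_in_topspace(2)[of X a]
    by (intro exI[of _ "topspace X"]) (auto simp: sheet_def based_join basedD)
  then have "openin cover_space (H_class ` Collect based)"
    by (simp add: openin_cover_space)
  then show "H_class ` Collect based \<subseteq> topspace cover_space"
    by (rule openin_subset)
  show "topspace cover_space \<subseteq> H_class ` Collect based"
    using openin_cover_space openin_topspace by blast
qed

lemma sheetI: "pathin (subtopology X U) g \<Longrightarrow> g 0 = a 1 \<Longrightarrow> H_class (a \<star> g) \<in> sheet U a"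
  by (auto simp: sheet_def)

lemma sheetE:
  assumes "A \<in> sheet U a"
  obtains g where "A = H_class (a \<star> g)" "pathin (subtopology X U) g" "g 0 = a 1"
  using assms unfolding sheet_def by blast

lemma H_class_in_sheet:
  assumes "based a" "a 1 \<in> U"
  shows "H_class a \<in> sheet U a"
proof -
  have "pathin (subtopology X U) (\<lambda>_. a 1)"
    using assms pathin_ends_in_topspace(2)[OF basedD(1)] by (simp add: pathin_const)
  then show ?thesis
    using sheetI[of U "\<lambda>_. a 1" a] H_class_const_right[OF assms(1)] by simp
qed

text \<open>If b amounts to a followed by g in U, then extending b by k in U amounts to extending a
  by \<open>g \<star> k\<close>, again in U.\<close>

lemma sheet_subset:
  assumes a: "based a" and b: "based b" "H_class b \<in> sheet U a"
  shows "sheet U b \<subseteq> sheet U a"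
proof
  fix A assume "A \<in> sheet U b"
  then obtain k where k: "A = H_class (b \<star> k)" "pathin (subtopology X U) k" "k 0 = b 1"
    by (rule sheetE)
  obtain g where g: "H_class b = H_class (a \<star> g)" "pathin (subtopology X U) g" "g 0 = a 1"
    using b(2) by (rule sheetE)
  have gk: "pathin X g" "pathin X k"
    using g k by (simp_all add: pathin_subtopology)
  have "b 1 = g 1"
    using g endpoint_H_class[OF b(1)] endpoint_H_class[OF based_join[OF a gk(1) g(3)]] by simp
  then have "A = H_class (a \<star> g \<star> k)" "pathin (subtopology X U) (g \<star> k)"
    using H_class_join_cong[OF b(1) g(1) gk(2) k(3)] H_class_assoc[of a g k] a g k gk
    by (simp_all add: pathin_join)
  then show "A \<in> sheet U a"
    using sheetI[of U "g \<star> k" a] g(3) by simp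
qed

text \<open>The path in U that leads from a to b is run backwards.\<close>

lemma sheet_sym:
  assumes a: "based a" and b: "based b" "H_class b \<in> sheet U a"
  shows "H_class a \<in> sheet U b"
proof -
  obtain g where g: "H_class b = H_class (a \<star> g)" "pathin (subtopology X U) g" "g 0 = a 1"
    using b(2) by (rule sheetE)
  have gX: "pathin X g"
    using g by (simp add: pathin_subtopology)
  have "b 1 = g 1"
    using g endpoint_H_class[OF b(1)] endpoint_H_class[OF based_join[OF a gX g(3)]] by simp
  then have "H_class (b \<star> path_rev g) = H_class ((a \<star> g) \<star> path_rev g)"
    using H_class_join_cong[OF b(1) g(1)] gX by (simp add: pathin_rev)
  also have "\<dots> = H_class (a \<star> g \<star> path_rev g)"
    using a gX g(3) by (intro H_class_assoc) (simp_all add: pathin_rev)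
  also have "\<dots> = H_class (a \<star> (\<lambda>_. a 1))"
    using a gX g(3)
    by (intro H_class_eqI path_homotopic_join_left path_homotopic_rev_right based_join)
      (simp_all add: path_simps)
  also have "\<dots> = H_class a"
    using a by (rule H_class_const_right)
  finally show ?thesis
    using sheetI[of U "path_rev g" b] g(2) \<open>b 1 = g 1\<close> by (simp add: pathin_rev)
qed

text \<open>For fixed U the sheets are thus the classes of an equivalence relation; this will make
  the sheets over U disjoint.\<close>

lemma sheet_eq:
  assumes "based a" "based b" "H_class b \<in> sheet U a"
  shows "sheet U b = sheet U a"
  using assms sheet_subset sheet_sym by (meson subset_antisym)

lemma sheet_subset_topspace: "based a \<Longrightarrow> sheet U a \<subseteq> topspace cover_space"
  by (auto simp: sheet_def topspace_cover_space pathin_subtopology based_join)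

lemma endpoint_sheet:
  assumes "based a" "A \<in> sheet U a"
  shows "endpoint A \<in> U"
  using assms by (auto simp: sheet_def endpoint_H_class based_join pathin_subtopology)

text \<open>By \<open>sheet_subset\<close> the same U works at every point of the sheet.\<close>

lemma openin_sheet:
  assumes "openin X U" "based a"
  shows "openin cover_space (sheet U a)"
  unfolding openin_cover_space
proof (intro conjI allI impI)
  show "sheet U a \<subseteq> H_class ` Collect based"
    using sheet_subset_topspace[OF assms(2)] by (simp add: topspace_cover_space)
  fix b assume b: "based b \<and> H_class b \<in> sheet U a"
  then have "b 1 \<in> U" "sheet U b \<subseteq> sheet U a"
    using endpoint_sheet[OF assms(2), of "H_class b" U] sheet_subset[OF assms(2)]
    by (simp_all add: endpoint_H_class)
  then show "\<exists>V. openin X V \<and> b 1 \<in> V \<and> sheet V b \<subseteq> sheet U a"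
    using assms(1) by blast
qed

section \<open>The end point map as a covering\<close>

lemma continuous_map_endpoint: "continuous_map cover_space X endpoint"
  unfolding continuous_map_def
proof (intro conjI allI impI)
  show "endpoint \<in> topspace cover_space \<rightarrow> topspace X"
    using pathin_ends_in_topspace(2) basedD
    by (fastforce simp: topspace_cover_space endpoint_H_class)
  fix V assume V: "openin X V"
  show "openin cover_space {A \<in> topspace cover_space. endpoint A \<in> V}" (is "openin _ ?W")
    unfolding openin_cover_space
  proof (intro conjI allI impI)
    show "?W \<subseteq> H_class ` Collect based"
      by (auto simp: topspace_cover_space)
    fix a assume a: "based a \<and> H_class a \<in> ?W"
    then show "\<exists>U. openin X U \<and> a 1 \<in> U \<and> sheet U a \<subseteq> ?W"
      using V sheet_subset_topspace endpoint_sheet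
      by (intro exI[of _ V]) (auto simp: endpoint_H_class)
  qed
qed

text \<open>Inside U there is a path connected open neighbourhood V of \<open>a 1\<close>. Each z in
  V is the end of a path in V from \<open>a 1\<close>, and extending a by it stays in the sheet,
  hence in W.\<close>

lemma open_map_endpoint:
  assumes "locally_path_connected_space X"
  shows "open_map cover_space X endpoint"
  unfolding open_map_def
proof (intro allI impI)
  fix W assume W: "openin cover_space W"
  show "openin X (endpoint ` W)"
  proof (subst openin_subopen, intro ballI)
    fix y assume "y \<in> endpoint ` W"
    then obtain a where a: "based a" "H_class a \<in> W" "y = a 1"
      using W by (auto simp: openin_cover_space endpoint_H_class)
    then obtain U where U: "openin X U" "a 1 \<in> U" "sheet U a \<subseteq> W"
      using W unfolding openin_cover_space by blast
    then obtain V where V: "openin X V" "path_connectedin X V" "a 1 \<in> V" "V \<subseteq> U"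
      using assms unfolding locally_path_connected_space by blast
    have "z \<in> endpoint ` W" if z: "z \<in> V" for z
    proof -
      obtain g where g: "pathin (subtopology X V) g" "g 0 = a 1" "g 1 = z"
        using V(2,3) z by (rule path_connectedin_obtain_path)
      then have gX: "pathin X g" and "pathin (subtopology X U) g"
        using V(4) by (auto simp: pathin_subtopology)
      then have "H_class (a \<star> g) \<in> W"
        using sheetI[of U g a] g U(3) by blast
      moreover have "endpoint (H_class (a \<star> g)) = z"
        using endpoint_H_class[OF based_join[OF a(1) gX g(2)]] g(3) by simp
      ultimately show ?thesis by blast
    qed
    then show "\<exists>T. openin X T \<and> y \<in> T \<and> T \<subseteq> endpoint ` W"
      using V a(3) by blast
  qed
qed

text \<open>Injectivity of \<open>endpoint\<close> on every sheet over U, expressed by paths. The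
  starting point \<open>a 1\<close> may be any point of U that a based path reaches.\<close>

definition H_small :: "'a set \<Rightarrow> bool"
  where "H_small U \<longleftrightarrow> (\<forall>a g k. based a \<longrightarrow> pathin (subtopology X U) g \<longrightarrow>
    pathin (subtopology X U) k \<longrightarrow> g 0 = a 1 \<longrightarrow> k 0 = a 1 \<longrightarrow> g 1 = k 1 \<longrightarrow>
    H_class (a \<star> g) = H_class (a \<star> k))"

text \<open>Path connectedness of U gives surjectivity, \<open>H_small\<close> injectivity, and
  local path connectedness the openness of the map.\<close>

lemma homeomorphic_map_sheet:
  assumes lpc: "locally_path_connected_space X"
    and U: "openin X U" "path_connectedin X U" "H_small U" and a: "based a" "a 1 \<in> U"
  shows "homeomorphic_map (subtopology cover_space (sheet U a)) (subtopology X U) endpoint"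
proof (rule bijective_open_imp_homeomorphic_map)
  have top: "topspace (subtopology cover_space (sheet U a)) = sheet U a"
    using inf.absorb2[OF sheet_subset_topspace[OF a(1)]] by simp
  have topU: "topspace (subtopology X U) = U"
    using inf.absorb2[OF openin_subset[OF U(1)]] by simp
  show "continuous_map (subtopology cover_space (sheet U a)) (subtopology X U) endpoint"
    using continuous_map_endpoint endpoint_sheet[OF a(1)]
    by (auto simp: continuous_map_in_subtopology top continuous_map_from_subtopology)
  show "open_map (subtopology cover_space (sheet U a)) (subtopology X U) endpoint"
    using open_map_from_subtopology[OF open_map_endpoint[OF lpc] openin_sheet[OF U(1) a(1)]]
      endpoint_sheet[OF a(1)]
    by (auto simp: open_map_into_subtopology top)
  show "endpoint ` topspace (subtopology cover_space (sheet U a)) = topspace (subtopology X U)"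
    unfolding top topU
  proof
    show "endpoint ` sheet U a \<subseteq> U"
      using endpoint_sheet[OF a(1)] by blast
    show "U \<subseteq> endpoint ` sheet U a"
    proof
      fix z assume "z \<in> U"
      with U(2) a(2) obtain g where g: "pathin (subtopology X U) g" "g 0 = a 1" "g 1 = z"
        by (rule path_connectedin_obtain_path)
      then have "endpoint (H_class (a \<star> g)) = z"
        using a(1) by (simp add: endpoint_H_class based_join pathin_subtopology)
      then show "z \<in> endpoint ` sheet U a"
        using sheetI[of U g a] g by blast
    qed
  qed
  show "inj_on endpoint (topspace (subtopology cover_space (sheet U a)))"
    unfolding top
  proof (rule inj_onI)
    fix A B assume AB: "A \<in> sheet U a" "B \<in> sheet U a" "endpoint A = endpoint B"
    obtain g where g: "A = H_class (a \<star> g)" "pathin (subtopology X U) g" "g 0 = a 1"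
      using AB(1) by (rule sheetE)
    obtain k where k: "B = H_class (a \<star> k)" "pathin (subtopology X U) k" "k 0 = a 1"
      using AB(2) by (rule sheetE)
    have "g 1 = k 1"
      using AB(3) a(1) g k by (simp add: endpoint_H_class based_join pathin_subtopology)
    then show "A = B"
      using U(3) a(1) g k unfolding H_small_def by blast
  qed
qed

lemma evenly_covered_endpoint:
  assumes lpc: "locally_path_connected_space X"
    and U: "openin X U" "path_connectedin X U" "H_small U"
  shows "evenly_covered cover_space X endpoint U"
  unfolding evenly_covered_def
proof (intro exI conjI ballI)
  let ?\<V> = "sheet U ` {a. based a \<and> a 1 \<in> U}"
  show "openin cover_space V" if "V \<in> ?\<V>" for V
    using that openin_sheet[OF U(1)] by blast
  show "homeomorphic_map (subtopology cover_space V) (subtopology X U) endpoint"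
    if "V \<in> ?\<V>" for V
    using that homeomorphic_map_sheet[OF lpc U] by blast
  show "\<Union>?\<V> = {A \<in> topspace cover_space. endpoint A \<in> U}"
    using sheet_subset_topspace endpoint_sheet H_class_in_sheet
    by (fastforce simp: topspace_cover_space endpoint_H_class)
  show "disjoint ?\<V>"
  proof (intro pairwiseI)
    fix V W assume "V \<in> ?\<V>" "W \<in> ?\<V>" "V \<noteq> W"
    then obtain a b where ab: "V = sheet U a" "W = sheet U b" "based a" "based b"
      by blast
    show "disjnt V W"
    proof (rule ccontr)
      \<comment> \<open>By \<open>sheet_eq\<close> both sheets coincide with the sheet around a
        common point c.\<close>
      assume "\<not> disjnt V W"
      then obtain c where c: "based c" "H_class c \<in> sheet U a" "H_class c \<in> sheet U b"
        using ab sheet_subset_topspace[OF ab(3)] by (auto simp: disjnt_iff topspace_cover_space)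
      then show False
        using sheet_eq[OF ab(3) c(1,2)] sheet_eq[OF ab(4) c(1,3)] ab \<open>V \<noteq> W\<close> by simp
    qed
  qed
qed

section \<open>Lifting paths, and the image of the fundamental group\<close>

definition lift :: "(real \<Rightarrow> 'a) \<Rightarrow> real \<Rightarrow> (real \<Rightarrow> 'a) set"
  where "lift a t = H_class (\<lambda>s. a (t * s))"

lemma based_initial_segment:
  assumes "based a" "t \<in> {0..1}"
  shows "based (\<lambda>s. a (t * s))"
proof -
  have "pathin X (a \<circ> (\<lambda>s. t * s))"
    using assms
    by (intro pathin_compose_unit_interval)
      (auto intro!: continuous_intros mult_le_one simp: based_def)
  then show ?thesis
    using assms by (simp add: based_def o_def)
qed

lemma lift_0: "based a \<Longrightarrow> lift a 0 = H_class (\<lambda>_. x)"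
  by (simp add: lift_def based_def)

lemma lift_1: "lift a 1 = H_class a"
  by (simp add: lift_def)

lemma endpoint_lift: "based a \<Longrightarrow> t \<in> {0..1} \<Longrightarrow> endpoint (lift a t) = a t"
  by (simp add: lift_def endpoint_H_class based_initial_segment)

text \<open>For s near t, the initial segment up to s is homotopic to the one up to t followed by
  the short piece of a between t and s. That piece stays in the neighbourhood U of
  \<open>a t\<close>, so \<open>lift a s\<close> is in the sheet around
  \<open>lift a t\<close>.\<close>

lemma pathin_lift:
  assumes a: "based a"
  shows "pathin cover_space (lift a)"
  unfolding pathin_def continuous_map_def
proof (intro conjI allI impI)
  show "lift a \<in> topspace unit_interval \<rightarrow> topspace cover_space"
    using based_initial_segment[OF a] by (auto simp: lift_def topspace_cover_space)
  fix W assume W: "openin cover_space W"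
  show "openin unit_interval {t \<in> topspace unit_interval. lift a t \<in> W}"
  proof (subst openin_subopen, intro ballI)
    fix t assume "t \<in> {t \<in> topspace unit_interval. lift a t \<in> W}"
    then have t: "t \<in> {0..1}" "lift a t \<in> W"
      by auto
    let ?a = "\<lambda>t s. a (t * s)"
    have "\<exists>U. openin X U \<and> ?a t 1 \<in> U \<and> sheet U (?a t) \<subseteq> W"
      using W t(2) based_initial_segment[OF a t(1)] unfolding openin_cover_space lift_def by blast
    then obtain U where U: "openin X U" "a t \<in> U" "sheet U (?a t) \<subseteq> W"
      by auto
    have "openin unit_interval {s \<in> {0..1}. a s \<in> U}"
      using openin_continuous_map_preimage[of unit_interval X a U] a U(1)
      by (simp add: based_def pathin_def)
    then have "\<exists>e>0. \<forall>s\<in>{0..1}. dist s t < e \<longrightarrow> a s \<in> U"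
      using t(1) U(2) unfolding openin_euclidean_subtopology_iff by blast
    then obtain e where e: "e > 0" "\<And>s. s \<in> {0..1} \<Longrightarrow> dist s t < e \<Longrightarrow> a s \<in> U"
      by blast
    define T where "T = {0..1} \<inter> ball t e"
    have "lift a s \<in> W" if "s \<in> T" for s
    proof -
      have s: "s \<in> {0..1}" "dist s t < e"
        using that by (auto simp: T_def dist_commute)
      \<comment> \<open>The piece of a from t to s; s may lie on either side of t, and for s < t it
        is run backwards.\<close>
      define g where "g = (\<lambda>r. a ((1 - r) * t + r * s))"
      have conv: "(1 - r) * t + r * s \<in> {0..1}" if "r \<in> {0..1}" for r
        using convex_bound_le[of t 1 s "1 - r" r] s t that by auto
      have pg: "pathin X (a \<circ> (\<lambda>r. (1 - r) * t + r * s))"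
        using a conv
        by (intro pathin_compose_unit_interval) (auto intro!: continuous_intros simp: based_def)
      have "g r \<in> U" if r: "r \<in> {0..1}" for r
      proof -
        have "dist ((1 - r) * t + r * s) t = r * dist s t"
        proof -
          have "(1 - r) * t + r * s - t = r * (s - t)"
            by (simp add: algebra_simps)
          then show ?thesis
            using r by (simp add: dist_real_def abs_mult)
        qed
        also have "\<dots> \<le> dist s t"
          using r by (simp add: mult_left_le_one_le)
        finally show ?thesis
          unfolding g_def using s(2) by (intro e(2) conv r) simp
      qed
      then have gU: "pathin (subtopology X U) g"
        using pg by (simp add: g_def o_def pathin_subtopology)
      define f where "f r = t * min 1 (2 * r) + (s - t) * max 0 (2 * r - 1)" for r
      have f: "f r = t * (2 * r)" if "r \<le> 1/2" for r
        using that by (simp add: f_def)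
      have f': "f r = (1 - (2 * r - 1)) * t + (2 * r - 1) * s" if "\<not> r \<le> 1/2" for r
        using that by (simp add: f_def algebra_simps)
      have f_range: "f r \<in> {0..1}" if r: "r \<in> {0..1}" for r
      proof (cases "r \<le> 1/2")
        case True
        then show ?thesis
          using mult_le_one[of t "2 * r"] t(1) r by (simp add: f)
      next
        case False
        then show ?thesis
          using conv[of "2 * r - 1"] r by (simp add: f')
      qed
      have "path_homotopic X (a \<circ> f) (a \<circ> (\<lambda>r. s * r))"
      proof (rule path_homotopic_reparametrize)
        show "pathin X a"
          using a by (rule basedD)
        show "continuous_on {0..1} f" "continuous_on {0..1} ((*) s)"
          unfolding f_def by (intro continuous_intros)+
        show "f ` {0..1} \<subseteq> {0..1}"
          using f_range by blast
        show "(*) s ` {0..1} \<subseteq> {0..1}"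
          using s(1) by (auto intro: mult_le_one)
        show "f 0 = s * 0" "f 1 = s * 1"
          by (simp_all add: f f')
      qed
      moreover have "a \<circ> f = ?a t \<star> g"
        by (rule ext) (simp add: f f' g_def path_join_def)
      moreover have "based (?a t \<star> g)"
        using based_initial_segment[OF a t(1)] pg by (intro based_join) (simp_all add: g_def o_def)
      ultimately have "lift a s = H_class (?a t \<star> g)"
        using H_class_eqI[of "?a t \<star> g" "a \<circ> (*) s"] by (simp add: lift_def o_def)
      then have "lift a s \<in> sheet U (?a t)"
        using sheetI[OF gU, of "?a t"] by (simp add: g_def)
      then show ?thesis
        using U(3) by blast
    qed
    moreover have "openin unit_interval T"
      unfolding T_def by (simp add: openin_open_Int)
    moreover have "t \<in> T"
      using t(1) e(1) by (simp add: T_def)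
    ultimately show "\<exists>T. openin unit_interval T \<and> t \<in> T \<and>
        T \<subseteq> {t \<in> topspace unit_interval. lift a t \<in> W}"
      by (intro exI[of _ T]) (auto simp: T_def)
  qed
qed

lemma path_connected_cover_space: "path_connected_space cover_space"
proof -
  have "path_component_of cover_space (H_class (\<lambda>_. x)) A"
    if A: "A \<in> topspace cover_space" for A
  proof -
    obtain a where "based a" "A = H_class a"
      using A by (auto simp: topspace_cover_space)
    then show ?thesis
      using pathin_lift[of a] lift_0[of a] lift_1[of a]
      unfolding path_component_of_def by (intro exI[of _ "lift a"]) simp
  qed
  then show ?thesis
    unfolding path_connected_space_iff_path_component
    by (meson path_component_of_sym path_component_of_trans)
qed

lemma covering_map_endpoint:
  assumes "locally_path_connected_space X"
    and "\<And>y. y \<in> topspace X \<Longrightarrow> \<exists>U. openin X U \<and> y \<in> U \<and> path_connectedin X U \<and> H_small U"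
  shows "covering_map cover_space X endpoint"
  unfolding covering_map_def
  using path_connected_cover_space continuous_map_endpoint evenly_covered_endpoint[OF assms(1)]
    assms(2) by blast

lemma image_fundamental_group_cover_space:
  assumes "covering_map cover_space X endpoint"
  shows "induced_map X endpoint ` carrier (fundamental_group cover_space (H_class (\<lambda>_. x))) = H"
proof
  show "induced_map X endpoint ` carrier (fundamental_group cover_space (H_class (\<lambda>_. x))) \<subseteq> H"
  proof
    fix A assume "A \<in> induced_map X endpoint ` carrier (fundamental_group cover_space (H_class (\<lambda>_. x)))"
    then obtain c where c: "loop_at cover_space (H_class (\<lambda>_. x)) c"
      "A = induced_map X endpoint (path_class cover_space c)"
      by (auto simp: carrier_fundamental_group)
    then have cp: "pathin cover_space c" "c 0 = H_class (\<lambda>_. x)" "c 1 = H_class (\<lambda>_. x)"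
      by (simp_all add: loop_at_def)
    have A: "A = path_class X (endpoint \<circ> c)"
      using c(2) induced_map_path_class[OF cp(1) continuous_map_endpoint] by simp
    have loop: "loop_at X x (endpoint \<circ> c)"
      using cp pathin_compose[OF cp(1) continuous_map_endpoint]
      by (simp add: loop_at_def endpoint_H_class based_const)
    then have based: "based (endpoint \<circ> c)"
      by (simp add: based_def loop_at_def)
    \<comment> \<open>c and the lift of its own projection start at the same point and lie over the
      same path, so they end together; the lift ends at the class of the projection.\<close>
    have "c 1 = lift (endpoint \<circ> c) 1"
      using endpoint_lift[OF based] lift_0[OF based] cp(2)
      by (intro covering_map_unique_lift[OF assms cp(1) pathin_lift[OF based]]) simp_all
    then show "A \<in> H"
      using H_class_eq_const_iff[OF loop] cp(3) A by (simp add: lift_1)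
  qed
  show "H \<subseteq> induced_map X endpoint ` carrier (fundamental_group cover_space (H_class (\<lambda>_. x)))"
  proof
    fix A assume A: "A \<in> H"
    then have "A \<in> carrier (fundamental_group X x)"
      using subgroup.subset[OF subgroup_H] by blast
    then obtain a where a: "A = path_class X a" "loop_at X x a"
      by (rule fundamental_groupE)
    have based: "based a"
      using a(2) by (simp add: based_def loop_at_def)
    have "loop_at cover_space (H_class (\<lambda>_. x)) (lift a)"
      using pathin_lift[OF based] lift_0[OF based] lift_1[of a] H_class_eq_const_iff[OF a(2)] A a(1)
      by (simp add: loop_at_def)
    moreover have "induced_map X endpoint (path_class cover_space (lift a)) = A"
    proof -
      \<comment> \<open>Outside the unit interval the two functions may differ, so they are compared
        up to homotopy.\<close>
      have "path_homotopic X a (endpoint \<circ> lift a)"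
        using endpoint_lift[OF based] basedD(1)[OF based] by (intro path_homotopic_eqI) simp_all
      then show ?thesis
        using induced_map_path_class[OF pathin_lift[OF based] continuous_map_endpoint]
          path_class_eqI a(1) by metis
    qed
    ultimately show "A \<in> induced_map X endpoint ` carrier (fundamental_group cover_space (H_class (\<lambda>_. x)))"
      by (auto simp: carrier_fundamental_group)
  qed
qed

text \<open>For a ending at y put l = g k^-1, a loop in U at y. Then a g is homotopic to (a l a^-1)
  a k, and change of base point along a puts the class of a l a^-1 into the Spanier group at x,
  hence into \<open>H\<close>. Other starting points in U are reduced to y.\<close>

lemma H_small_path_connected:
  assumes sp: "spanier_group X x \<subseteq> H"
    and U: "y \<in> U" "path_connectedin X U"
    and loops: "\<And>p. loop_at (subtopology X U) y p \<Longrightarrow> path_class X p \<in> spanier_group X y"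
  shows "H_small U"
  unfolding H_small_def
proof (intro allI impI)
  \<comment> \<open>The assumption on loops speaks of loops at y only, so paths ending at y are
    treated first.\<close>
  have at_y: "H_class (a \<star> g) = H_class (a \<star> k)"
    if a: "based a" "a 1 = y" and g: "pathin (subtopology X U) g" "g 0 = y"
      and k: "pathin (subtopology X U) k" "k 0 = y" and gk: "g 1 = k 1" for a g k
  proof -
    have X: "pathin X g" "pathin X k"
      using g k by (simp_all add: pathin_subtopology)
    define l where "l = g \<star> path_rev k"
    have "loop_at (subtopology X U) y l"
      using g k gk by (simp add: l_def loop_at_def pathin_join pathin_rev)
    moreover have l: "loop_at X y l"
      using X g k gk by (simp add: l_def loop_at_def pathin_join pathin_rev)
    ultimately have "path_class X (a \<star> l \<star> path_rev a) \<in> H"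
      using spanier_group_change_base[of X a x y l] a loops sp by (auto simp: based_def)
    then have h: "H_loop (a \<star> l \<star> path_rev a)"
      using l a by (simp add: H_loop_def loop_at_def based_def pathin_join pathin_rev)
    note path = X g(2) k(2) gk a(2) basedD[OF a(1)] l[unfolded loop_at_def] pathin_join pathin_rev
    \<comment> \<open>Inserting k^-1 k at the end produces l, and inserting a^-1 a before the last k
      splits off the loop in \<open>H\<close> on the left.\<close>
    have "path_homotopic X (a \<star> g) (a \<star> g \<star> (\<lambda>_. k 1))"
      by (intro path_homotopic_join_left path_homotopic_sym[OF path_homotopic_const_right])
        (simp_all add: path)
    also have "path_homotopic X \<dots> (a \<star> g \<star> path_rev k \<star> k)"
      by (intro path_homotopic_join_left path_homotopic_sym[OF path_homotopic_rev_left])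
        (simp_all add: path)
    also have "path_homotopic X \<dots> (a \<star> l \<star> k)"
      unfolding l_def
      by (intro path_homotopic_join_left path_homotopic_sym[OF path_homotopic_assoc])
        (simp_all add: path)
    also have "path_homotopic X \<dots> (a \<star> l \<star> path_rev a \<star> a \<star> k)"
      by (intro path_homotopic_join_left path_homotopic_sym[OF path_homotopic_rev_cancel'])
        (simp_all add: path)
    also have "path_homotopic X \<dots> (a \<star> (l \<star> path_rev a) \<star> a \<star> k)"
      by (intro path_homotopic_join_left path_homotopic_sym[OF path_homotopic_assoc])
        (simp_all add: path)
    also have "path_homotopic X \<dots> ((a \<star> l \<star> path_rev a) \<star> a \<star> k)"
      by (intro path_homotopic_sym[OF path_homotopic_assoc]) (simp_all add: path)
    finally have "H_related (a \<star> g) (a \<star> k)"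
      using h based_join[of a k] a X k by (auto simp: H_related_def)
    then show ?thesis
      using H_class_eq_iff based_join a X g by simp
  qed
  fix a g k
  assume a: "based a" and g: "pathin (subtopology X U) g" "g 0 = a 1"
    and k: "pathin (subtopology X U) k" "k 0 = a 1" and gk: "g 1 = k 1"
  have X: "pathin X g" "pathin X k"
    using g k by (simp_all add: pathin_subtopology)
  have "a 1 \<in> U"
    using g by (force simp: pathin_subtopology)
  with U(2,1) obtain w where w: "pathin (subtopology X U) w" "w 0 = y" "w 1 = a 1"
    using path_connectedin_obtain_path by metis
  then have wX: "pathin X w"
    by (simp add: pathin_subtopology)
  note w = w wX
  \<comment> \<open>The path a is replaced by \<open>a \<star> path_rev w\<close>, which ends at y,
    and its extension r by \<open>w \<star> r\<close>. As w lies in U, the case already settled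
    applies to \<open>w \<star> g\<close> and \<open>w \<star> k\<close>.\<close>
  have detour: "H_class ((a \<star> path_rev w) \<star> w \<star> r) = H_class (a \<star> r)"
    if "pathin X r" "r 0 = a 1" for r
  proof (intro H_class_eqI)
    have "path_homotopic X ((a \<star> path_rev w) \<star> w \<star> r) (a \<star> path_rev w \<star> w \<star> r)"
      using a w that by (intro path_homotopic_assoc) (simp_all add: path_simps)
    also have "path_homotopic X \<dots> (a \<star> r)"
      using a w that
      by (intro path_homotopic_join_left path_homotopic_rev_cancel') (simp_all add: path_simps)
    finally show "path_homotopic X ((a \<star> path_rev w) \<star> w \<star> r) (a \<star> r)" .
    show "based ((a \<star> path_rev w) \<star> w \<star> r)"
      using a w that by (simp add: path_simps)
  qed
  have "H_class ((a \<star> path_rev w) \<star> w \<star> g) = H_class ((a \<star> path_rev w) \<star> w \<star> k)"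
    using a w g k gk by (intro at_y) (simp_all add: path_simps)
  then show "H_class (a \<star> g) = H_class (a \<star> k)"
    using detour X g k by simp
qed

end

theorem theorem4p6:
  fixes X :: "'a topology" and x :: 'a and H :: "(real \<Rightarrow> 'a) set set"
  assumes "connected_space X" and "locally_path_connected_space X"
    and "semilocally_spanier_space X" and "x \<in> topspace X"
    and "subgroup H (fundamental_group X x)" and "spanier_group X x \<subseteq> H"
  shows "\<exists>(E :: (real \<Rightarrow> 'a) set topology) p e.
    covering_map E X p \<and> e \<in> topspace E \<and> p e = x \<and>
    induced_map X p ` carrier (fundamental_group E e) = H"
proof -
  interpret subgroup_cover X x H
    using assms(4,5) by (rule subgroup_cover.intro)
  have "\<exists>U. openin X U \<and> y \<in> U \<and> path_connectedin X U \<and> H_small U" if "y \<in> topspace X" for y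
  proof -
    obtain V where V: "openin X V" "y \<in> V"
      "induced_map X id ` carrier (fundamental_group (subtopology X V) y) \<subseteq> spanier_group X y"
      using assms(3) \<open>y \<in> topspace X\<close> unfolding semilocally_spanier_space_def by blast
    obtain U where U: "openin X U" "path_connectedin X U" "y \<in> U" "U \<subseteq> V"
      using assms(2) V(1,2) unfolding locally_path_connected_space by blast
    have "path_class X p \<in> spanier_group X y" if "loop_at (subtopology X U) y p" for p
    proof -
      have p: "loop_at (subtopology X V) y p"
        using that U(4) by (auto simp: loop_at_def pathin_subtopology)
      \<comment> \<open>A class in V consists only of loops in V; the map induced by the inclusion
        passes to the full class in X, for which the hypothesis is stated.\<close>
      then have "induced_map X id (path_class (subtopology X V) p) = path_class X p"
        using induced_map_path_class[of "subtopology X V" p X id]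
        by (simp add: loop_at_def continuous_map_from_subtopology)
      then show ?thesis
        using p V(3) by (force simp: carrier_fundamental_group)
    qed
    then have "H_small U"
      using assms(6) U by (intro H_small_path_connected) auto
    then show ?thesis
      using U by blast
  qed
  then have cov: "covering_map cover_space X endpoint"
    using assms(2) by (intro covering_map_endpoint)
  then show ?thesis
    using image_fundamental_group_cover_space[OF cov] endpoint_H_class[OF based_const] based_const
    by (intro exI[of _ cover_space] exI[of _ endpoint] exI[of _ "H_class (\<lambda>_. x)"])
      (simp add: topspace_cover_space)
qed

end
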